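(* Let $X$ be a Banach space and let $H\in F(X)$ be convex with $\operatorname{argmin}H\neq\emptyset$. If $H$ is firmly subdifferentiable at a point of $\operatorname{argmin}H$, then $H$ is coercive and attains a strong minimum over $X$.
   Context: $X$ is a (real) Banach space with topological dual $X^*$; $\langle x,x^*\rangle:=x^*(x)$. $F(X)$ is the class of functions $J:X\to\mathbb{R}\cup\{+\infty\}$ with $\operatorname{dom}J:=\{x\in X: J(x)<\infty\}\neq\emptyset$. $\operatorname{argmin}H$ is the set of minimum points of $H$ over $X$. Subdifferential: $\partial H(x):=\{x^*\in X^*: H(u)\ge H(x)+\langle u-x,x^*\rangle\ \forall u\in X\}$ if $H(x)\in\mathbb{R}$, and $\emptyset$ otherwise; $\operatorname{dom}\partial H:=\{x:\partial H(x)\ne\emptyset\}$. $\Gamma_0$ is the set of lower semicontinuous convex functions $\psi:\mathbb{R}_+\to[0,\infty]$ such that $\psi(t)=0\iff t=0$. A convex function $H\in F(X)$ is firmly subdifferentiable at $x\in\operatorname{dom}\partial H$ if for every $x^*\in\partial H(x)$ there exists $\psi\in\Gamma_0$ such that $H(u)\ge H(x)+\langle u-x,x^*\rangle+\psi(\|u-x\|)$ for all $u\in X$. $H$ is coercive if $\lim_{\|u\|\to\infty}H(u)=+\infty$. $H$ attains a strong minimum over $X$ if it has a minimum point $\bar x\in X$ and every sequence $(x_n)$ with $H(x_n)\to\inf_X H$ converges in norm to $\bar x$. *)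

theory Defs
  imports "HOL-Analysis.Analysis"
begin

(* Extended-real-valued functions are modelled in ereal. The topological dual of X is the type
   of bounded linear functionals from X to the reals. *)

(* The class F(X): values in the reals with +infinity, nonempty effective domain. *)
definition proper_fun :: "('a \<Rightarrow> ereal) \<Rightarrow> bool" where
  "proper_fun J \<longleftrightarrow> (\<forall>x. J x \<noteq> -\<infinity>) \<and> {x. J x < \<infinity>} \<noteq> {}"

(* convex_on is real-valued only. The weights are kept strictly between 0 and 1, so that the
   convention 0 * \<infinity> = 0 plays no role; all functions below avoid -\<infinity> on S, so the sum on the
   right is never of the form \<infinity> + -\<infinity>. *)
definition convex_ereal_on :: "'a::real_vector set \<Rightarrow> ('a \<Rightarrow> ereal) \<Rightarrow> bool" where
  "convex_ereal_on S f \<longleftrightarrow> convex S \<and>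
     (\<forall>x\<in>S. \<forall>y\<in>S. \<forall>t::real. 0 < t \<and> t < 1 \<longrightarrow>
        f ((1 - t) *\<^sub>R x + t *\<^sub>R y) \<le> ereal (1 - t) * f x + ereal t * f y)"

definition lsc_on :: "'a::topological_space set \<Rightarrow> ('a \<Rightarrow> ereal) \<Rightarrow> bool" where
  "lsc_on S f \<longleftrightarrow> (\<forall>x\<in>S. f x \<le> Liminf (at x within S) f)"

definition argmin_set :: "('a \<Rightarrow> ereal) \<Rightarrow> 'a set" where
  "argmin_set H = {x. \<forall>u. H x \<le> H u}"

definition subdifferential ::
    "('a::real_normed_vector \<Rightarrow> ereal) \<Rightarrow> 'a \<Rightarrow> ('a \<Rightarrow>\<^sub>L real) set" where
  "subdifferential H x =
     (if \<bar>H x\<bar> \<noteq> \<infinity>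
      then {x'. \<forall>u. H u \<ge> H x + ereal (blinfun_apply x' (u - x))}
      else {})"

definition dom_subdifferential :: "('a::real_normed_vector \<Rightarrow> ereal) \<Rightarrow> 'a set" where
  "dom_subdifferential H = {x. subdifferential H x \<noteq> {}}"

(* Elements are functions on the nonnegative reals; the values at negative arguments are
   irrelevant. *)
definition Gamma0 :: "(real \<Rightarrow> ereal) set" where
  "Gamma0 = {\<psi>. (\<forall>t\<ge>0. 0 \<le> \<psi> t) \<and> lsc_on {0..} \<psi> \<and> convex_ereal_on {0..} \<psi> \<and>
                 (\<forall>t\<ge>0. \<psi> t = 0 \<longleftrightarrow> t = 0)}"

definition firmly_subdifferentiable_at ::
    "('a::real_normed_vector \<Rightarrow> ereal) \<Rightarrow> 'a \<Rightarrow> bool" where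
  "firmly_subdifferentiable_at H x \<longleftrightarrow>
     x \<in> dom_subdifferential H \<and>
     (\<forall>x'\<in>subdifferential H x. \<exists>\<psi>\<in>Gamma0. \<forall>u.
        H u \<ge> H x + ereal (blinfun_apply x' (u - x)) + \<psi> (norm (u - x)))"

definition coercive :: "('a::real_normed_vector \<Rightarrow> ereal) \<Rightarrow> bool" where
  "coercive H \<longleftrightarrow> (H \<longlongrightarrow> \<infinity>) at_infinity"

definition attains_strong_minimum :: "('a::real_normed_vector \<Rightarrow> ereal) \<Rightarrow> bool" where
  "attains_strong_minimum H \<longleftrightarrow>
     (\<exists>z\<in>argmin_set H. \<forall>X :: nat \<Rightarrow> 'a.
        (\<lambda>n. H (X n)) \<longlonglongrightarrow> (INF u. H u) \<longrightarrow> X \<longlonglongrightarrow> z)"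

end

theory Submission
  imports Defs
begin

text \<open>
  At a minimum point \<open>z\<close> the zero functional is a subgradient, so firm subdifferentiability at \<open>z\<close>
  supplies a single \<open>\<psi>\<close> in \<^const>\<open>Gamma0\<close> with \<open>H u \<ge> H z + \<psi> (norm (u - z))\<close> for all \<open>u\<close>. Because
  \<open>\<psi>\<close> is convex, positive away from \<open>0\<close> and vanishes at \<open>0\<close>, it grows at least linearly outside
  every neighbourhood of \<open>0\<close> (lemma \<open>Gamma0_linear_growth\<close>). Hence, on the complement of any ball
  around \<open>z\<close>, \<open>H\<close> exceeds its minimum by a positive multiple of the distance to \<open>z\<close>
  (lemma \<open>linear_growth_of_firm_minimum\<close>). Applied to one ball, this gives coercivity; applied to
  arbitrarily small balls, it forces every minimizing sequence to converge to \<open>z\<close>.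
\<close>

text \<open>
  The slope \<open>\<psi> t / t\<close> of the chord from the origin to the graph is nondecreasing by convexity and
  \<open>\<psi> 0 = 0\<close>, so the slope at \<open>s\<close> bounds all later ones from below.
\<close>

lemma Gamma0_linear_growth:
  assumes psi: "\<psi> \<in> Gamma0" and s: "0 < s"
  obtains c where "0 < c" and "\<And>t. s \<le> t \<Longrightarrow> ereal (c * t) \<le> \<psi> t"
proof -
  have psi0: "\<psi> 0 = 0" and conv: "convex_ereal_on {0..} \<psi>"
    using psi by (auto simp: Gamma0_def)
  have "0 < \<psi> s"
    using psi s by (auto simp: Gamma0_def less_le)
  \<comment> \<open>The slope itself may be infinite, so a finite positive minorant \<open>r\<close> of \<open>\<psi> s\<close> replaces \<open>\<psi> s\<close>.\<close>
  then obtain r where r: "0 < r" "ereal r < \<psi> s"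
    using ereal_dense2[of 0 "\<psi> s"] by auto
  have "ereal (r / s * t) \<le> \<psi> t" if t: "s \<le> t" for t
  proof (cases "s = t")
    case True
    then show ?thesis using r s by (simp add: less_imp_le)
  next
    case False
    then have l: "0 < s / t" "s / t < 1" and t0: "0 < t" using s t by auto
    have "\<psi> ((1 - s / t) *\<^sub>R 0 + (s / t) *\<^sub>R t)
            \<le> ereal (1 - s / t) * \<psi> 0 + ereal (s / t) * \<psi> t"
      using conv l t0 unfolding convex_ereal_on_def by (metis atLeast_iff less_imp_le order_refl)
    then have "\<psi> s \<le> ereal (s / t) * \<psi> t"
      using t0 psi0 by simp
    with r(2) have *: "ereal r < ereal (s / t) * \<psi> t" by simp
    show ?thesis
    proof (cases "\<psi> t")
      case (real p)
      with * have "r < s / t * p" by simp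
      then show ?thesis using s t0 real by (simp add: field_simps)
    next
      case MInf
      then show ?thesis using psi t0 by (auto simp: Gamma0_def dest: spec[of _ t])
    qed simp
  qed
  moreover have "0 < r / s" using r s by simp
  ultimately show ?thesis using that by blast
qed

lemma zero_in_subdifferential_argmin:
  assumes "z \<in> argmin_set H" "\<bar>H z\<bar> \<noteq> \<infinity>"
  shows "0 \<in> subdifferential H z"
  using assms by (auto simp: subdifferential_def argmin_set_def)

lemma finite_on_dom_subdifferential:
  assumes "x \<in> dom_subdifferential H"
  shows "\<bar>H x\<bar> \<noteq> \<infinity>"
  using assms by (auto simp: dom_subdifferential_def subdifferential_def split: if_splits)

text \<open>
  Growth away from a firm minimum point. The constant \<open>c\<close> depends on the radius \<open>e\<close>: if
  \<open>H u = (norm u)\<^sup>2\<close>, for instance, it has to tend to \<open>0\<close> with \<open>e\<close>.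
\<close>

lemma linear_growth_of_firm_minimum:
  assumes z: "z \<in> argmin_set H" and firm: "firmly_subdifferentiable_at H z" and e: "0 < e"
  obtains c where "0 < c" and "\<And>u. e \<le> norm (u - z) \<Longrightarrow> H z + ereal (c * norm (u - z)) \<le> H u"
proof -
  have "0 \<in> subdifferential H z"
    using z firm
    by (auto simp: firmly_subdifferentiable_at_def
        intro!: zero_in_subdifferential_argmin finite_on_dom_subdifferential)
  then obtain \<psi> where psi: "\<psi> \<in> Gamma0"
    and H: "\<And>u. H z + ereal (blinfun_apply 0 (u - z)) + \<psi> (norm (u - z)) \<le> H u"
    using firm unfolding firmly_subdifferentiable_at_def by blast
  obtain c where c: "0 < c" "\<And>t. e \<le> t \<Longrightarrow> ereal (c * t) \<le> \<psi> t"
    using Gamma0_linear_growth[OF psi e] by blast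
  have "H z + ereal (c * norm (u - z)) \<le> H u" if "e \<le> norm (u - z)" for u
  proof -
    have "H z + ereal (c * norm (u - z)) \<le> H z + \<psi> (norm (u - z))"
      using c(2)[OF that] by (intro add_left_mono)
    also have "\<dots> \<le> H u" using H[of u] by (simp flip: zero_ereal_def)
    finally show ?thesis .
  qed
  with c(1) show ?thesis using that by blast
qed

lemma coercive_of_linear_growth:
  fixes H :: "'a::real_normed_vector \<Rightarrow> ereal"
  assumes c: "0 < c" and growth: "\<And>u. e \<le> norm (u - z) \<Longrightarrow> ereal (h + c * norm (u - z)) \<le> H u"
  shows "coercive H"
  unfolding coercive_def tendsto_PInfty
proof
  fix r :: real
  define R where "R = \<bar>e\<bar> + \<bar>r - h\<bar> / c + 1"
  have "ereal r < H u" if u: "norm z + R \<le> norm u" for u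
  proof -
    have R: "R \<le> norm (u - z)"
      using u norm_triangle_ineq2[of u z] by simp
    have "0 \<le> \<bar>r - h\<bar> / c" using c by simp
    then have "e \<le> R" by (simp add: R_def)
    with R have H: "ereal (h + c * norm (u - z)) \<le> H u" by (intro growth) simp
    have "r - h < \<bar>r - h\<bar> + c" using c by linarith
    also have "\<dots> = c * (\<bar>r - h\<bar> / c + 1)" using c by (simp add: distrib_left)
    also have "\<dots> \<le> c * norm (u - z)" using c R by (intro mult_left_mono) (auto simp: R_def)
    finally have "ereal r < ereal (h + c * norm (u - z))" by simp
    then show ?thesis using H by (rule less_le_trans)
  qed
  then show "eventually (\<lambda>u. ereal r < H u) at_infinity"
    unfolding eventually_at_infinity by blast
qed

lemma INF_eq_of_argmin:
  assumes "z \<in> argmin_set H"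
  shows "(INF u. H u) = H z"
  using assms by (intro antisym INF_lower INF_greatest) (auto simp: argmin_set_def)

theorem proposition5:
  fixes H :: "'a::banach \<Rightarrow> ereal"
  assumes "proper_fun H"
    and "convex_ereal_on UNIV H"
    and "argmin_set H \<noteq> {}"
    and "\<exists>x\<in>argmin_set H. firmly_subdifferentiable_at H x"
  shows "coercive H \<and> attains_strong_minimum H"
proof -
  obtain z where z: "z \<in> argmin_set H" and firm: "firmly_subdifferentiable_at H z"
    using assms(4) by blast
  have "\<bar>H z\<bar> \<noteq> \<infinity>"
    using firm by (auto simp: firmly_subdifferentiable_at_def intro!: finite_on_dom_subdifferential)
  then obtain h where h: "H z = ereal h" by auto
  have "coercive H"
  proof -
    obtain c where "0 < c" "\<And>u. 1 \<le> norm (u - z) \<Longrightarrow> H z + ereal (c * norm (u - z)) \<le> H u"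
      using linear_growth_of_firm_minimum[OF z firm, of 1] by auto
    then show ?thesis using h by (intro coercive_of_linear_growth[of c 1 z h]) auto
  qed
  moreover have "X \<longlonglongrightarrow> z" if X: "(\<lambda>n. H (X n)) \<longlonglongrightarrow> (INF u. H u)" for X :: "nat \<Rightarrow> 'a"
  proof (rule tendstoI)
    fix e :: real assume e: "0 < e"
    obtain c where c: "0 < c"
      and growth: "\<And>u. e \<le> norm (u - z) \<Longrightarrow> H z + ereal (c * norm (u - z)) \<le> H u"
      using linear_growth_of_firm_minimum[OF z firm e] by blast
    \<comment> \<open>Outside the ball of radius \<open>e\<close>, \<open>H\<close> stays above the level \<open>h + c * e\<close>, which lies
        strictly above the infimum.\<close>
    have near: "dist u z < e" if "H u < ereal (h + c * e)" for u
    proof (rule ccontr)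
      assume "\<not> dist u z < e"
      then have far: "e \<le> norm (u - z)" by (simp add: dist_norm)
      have "ereal (h + c * e) \<le> H z + ereal (c * norm (u - z))" using far c h by simp
      also have "\<dots> \<le> H u" using far by (rule growth)
      finally show False using that by simp
    qed
    have "(INF u. H u) < ereal (h + c * e)"
      using c e h by (simp add: INF_eq_of_argmin[OF z])
    from order_tendstoD(2)[OF X this]
    show "eventually (\<lambda>n. dist (X n) z < e) sequentially"
      by (rule eventually_mono) (rule near)
  qed
  ultimately show ?thesis
    using z unfolding attains_strong_minimum_def by blast
qed

end
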